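(* Let $\mathcal{R}=\{1,\dots,n\}$ be a route set with durations $l_i\in\mathbb{R}$, $T>0$ a period, and $\boldsymbol{\theta}\in[0,T)^n$ a timetable. For shortest path routing, and for logit routing with parameter $\beta>0$, let $\delta,\tau,\Delta$ be the corresponding characteristic values of the timetable. Under uniform arrivals, the corresponding timetable measure satisfies $$\mathcal{M}^{TT}(\mathcal{R},T,\boldsymbol{\theta})=\frac1T\sum_{i\in\mathcal{R}}\left(\frac12\delta_i^2+\tau_i\delta_i\right)=\frac1T\sum_{i\in\mathcal{R}}\left(\frac12\Delta_i^2+\tau_i\Delta_i\right).$$
   Context: For $x\in\mathbb{R}$, $[x]_T$ denotes the element of $[0,T)$ differing from $x$ by an integer multiple of $T$. The routes are ordered cyclically by departure time $\theta_i$, with routes departing at the same time ordered by index; $\pi(i)$ and $\sigma(i)$ denote the predecessor and successor of $i$ in this cyclic order. For a traveler with preferred departure time $t$, the observed route set $\mathcal{R}_\theta(t)$ has durations $l_i+[\theta_i-t]_T$, $i\in\mathcal{R}$. The observed route set measure is $\mathcal{M}^{RS}_{sp}(\mathcal{R}_\theta(t))=\min_{i\in\mathcal{R}}\{l_i+[\theta_i-t]_T\}$ for shortest path routing and $\mathcal{M}^{RS}_{logit}(\mathcal{R}_\theta(t))=-\frac1\beta\log\left(\sum_{i\in\mathcal{R}}e^{-\beta(l_i+[\theta_i-t]_T)}\right)$ for logit routing. The timetable measure under uniform arrivals is $\mathcal{M}^{TT}(\mathcal{R},T,\boldsymbol{\theta})=\mathbb{E}_t\left(\mathcal{M}^{RS}(\mathcal{R}_\theta(t))\right)$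 with $t$ uniformly distributed on $[0,T)$. Characteristic values: let $w(i,j)=T$ if $\theta_i=\theta_j$ and $j<i$, and $w(i,j)=[\theta_j-\theta_i]_T$ otherwise. If $n=1$, then $\delta_1=T$ and $\tau_1=l_1$. If $n\ge2$, then for every $i\in\mathcal{R}$: $\delta_i=w(\pi(i),i)$; $\tau_i=\min_{j\in\mathcal{R}}\{l_j+w(i,j)\}$ for shortest path routing, and $\tau_i=-\frac1\beta\log\left(\sum_{j\in\mathcal{R}}e^{-\beta(l_j+w(i,j))}\right)$ for logit routing. In all cases $\Delta_i=\delta_{\sigma(i)}+\tau_{\sigma(i)}-\tau_i$. *)

theory Defs
  imports "HOL-Probability.Probability" "HOL-Library.Real_Mod"
begin

text \<open>
  The route set is \<open>{1..n}\<close>; durations \<open>l\<close> and departure times \<open>\<theta>\<close> are functions of type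
  \<open>nat \<Rightarrow> real\<close> of which only the values on \<open>{1..n}\<close> matter. For \<open>T > 0\<close>, the representative
  of \<open>x\<close> in \<open>[0,T)\<close> modulo \<open>T\<close> is \<open>x rmod T\<close>.
\<close>

lemma rmod_representative:
  fixes x T :: real
  assumes "T > 0"
  shows "x rmod T \<in> {0..<T}" and "\<exists>k::int. x rmod T = x + of_int k * T"
proof -
  show "x rmod T \<in> {0..<T}"
    using assms rmod_less[of T x] by (simp add: rmod_nonneg)
  have "x rmod T = x + of_int (- \<lfloor>x / T\<rfloor>) * T"
    using assms by (simp add: rmod_def)
  then show "\<exists>k::int. x rmod T = x + of_int k * T" ..
qed

datatype routing = Shortest_Path | Logit real

fun aggregate :: "routing \<Rightarrow> nat \<Rightarrow> (nat \<Rightarrow> real) \<Rightarrow> real" where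
  "aggregate Shortest_Path n d = Min (d ` {1..n})"
| "aggregate (Logit \<beta>) n d = - (1 / \<beta>) * ln (\<Sum>i\<in>{1..n}. exp (- \<beta> * d i))"

definition observed_duration ::
    "(nat \<Rightarrow> real) \<Rightarrow> real \<Rightarrow> (nat \<Rightarrow> real) \<Rightarrow> real \<Rightarrow> nat \<Rightarrow> real" where
  "observed_duration l T \<theta> t i = l i + (\<theta> i - t) rmod T"

definition observed_measure ::
    "routing \<Rightarrow> nat \<Rightarrow> (nat \<Rightarrow> real) \<Rightarrow> real \<Rightarrow> (nat \<Rightarrow> real) \<Rightarrow> real \<Rightarrow> real" where
  "observed_measure r n l T \<theta> t = aggregate r n (observed_duration l T \<theta> t)"

definition timetable_measure ::
    "routing \<Rightarrow> nat \<Rightarrow> (nat \<Rightarrow> real) \<Rightarrow> real \<Rightarrow> (nat \<Rightarrow> real) \<Rightarrow> real" where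
  "timetable_measure r n l T \<theta> =
     (\<integral>t. observed_measure r n l T \<theta> t \<partial>(uniform_measure lborel {0..<T}))"

definition departs_before :: "(nat \<Rightarrow> real) \<Rightarrow> nat \<Rightarrow> nat \<Rightarrow> bool" where
  "departs_before \<theta> i j \<longleftrightarrow> \<theta> i < \<theta> j \<or> (\<theta> i = \<theta> j \<and> i < j)"

definition first_route :: "(nat \<Rightarrow> real) \<Rightarrow> nat set \<Rightarrow> nat" where
  "first_route \<theta> A = (THE i. i \<in> A \<and> (\<forall>j\<in>A. j \<noteq> i \<longrightarrow> departs_before \<theta> i j))"

definition last_route :: "(nat \<Rightarrow> real) \<Rightarrow> nat set \<Rightarrow> nat" where
  "last_route \<theta> A = (THE i. i \<in> A \<and> (\<forall>j\<in>A. j \<noteq> i \<longrightarrow> departs_before \<theta> j i))"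

text \<open>
  The neighbours in the cyclic order wrap around at the ends of the linear order
  \<^const>\<open>departs_before\<close>; a single route is its own predecessor and successor.
\<close>

definition succ_route :: "nat \<Rightarrow> (nat \<Rightarrow> real) \<Rightarrow> nat \<Rightarrow> nat" where
  "succ_route n \<theta> i =
     (let later = {j \<in> {1..n}. departs_before \<theta> i j}
      in first_route \<theta> (if later = {} then {1..n} else later))"

definition pred_route :: "nat \<Rightarrow> (nat \<Rightarrow> real) \<Rightarrow> nat \<Rightarrow> nat" where
  "pred_route n \<theta> i =
     (let earlier = {j \<in> {1..n}. departs_before \<theta> j i}
      in last_route \<theta> (if earlier = {} then {1..n} else earlier))"

definition wait :: "real \<Rightarrow> (nat \<Rightarrow> real) \<Rightarrow> nat \<Rightarrow> nat \<Rightarrow> real" where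
  "wait T \<theta> i j = (if \<theta> i = \<theta> j \<and> j < i then T else (\<theta> j - \<theta> i) rmod T)"

definition char_delta :: "nat \<Rightarrow> real \<Rightarrow> (nat \<Rightarrow> real) \<Rightarrow> nat \<Rightarrow> real" where
  "char_delta n T \<theta> i = (if n = 1 then T else wait T \<theta> (pred_route n \<theta> i) i)"

definition char_tau ::
    "routing \<Rightarrow> nat \<Rightarrow> (nat \<Rightarrow> real) \<Rightarrow> real \<Rightarrow> (nat \<Rightarrow> real) \<Rightarrow> nat \<Rightarrow> real" where
  "char_tau r n l T \<theta> i =
     (if n = 1 then l i else aggregate r n (\<lambda>j. l j + wait T \<theta> i j))"

definition char_Delta ::
    "routing \<Rightarrow> nat \<Rightarrow> (nat \<Rightarrow> real) \<Rightarrow> real \<Rightarrow> (nat \<Rightarrow> real) \<Rightarrow> nat \<Rightarrow> real" where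
  "char_Delta r n l T \<theta> i =
     char_delta n T \<theta> (succ_route n \<theta> i) + char_tau r n l T \<theta> (succ_route n \<theta> i)
       - char_tau r n l T \<theta> i"

end

theory Submission
  imports Defs
begin

text \<open>
  A traveler with preferred time \<open>t\<close> sees route \<open>j\<close> depart after a wait
  \<open>u j = (\<theta> j - t) rmod T\<close>, so \<open>u\<close> is the timetable read from the origin \<open>t\<close>. Waiting times
  between routes do not depend on the origin (\<open>wait_change_origin\<close>). If \<open>i\<close> is the first
  route of \<open>u\<close>, the wait for any \<open>j\<close> therefore splits as \<open>u j = u i + wait T \<theta> i j\<close>. Both ways
  of aggregating durations commute with the addition of a constant, so the traveler's
  measure is \<open>\<tau> i + u i\<close>: wait for the next departure, then behave like a traveler whose
  preferred time is \<open>\<theta> i\<close>.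

  The next departure is \<open>i\<close> exactly when \<open>u i < \<delta> i\<close> (\<open>less_char_delta_iff_first\<close>), because
  \<open>\<delta> i\<close> is the gap between \<open>i\<close> and the departure before it. Hence the observed measure is the
  sum over all routes of \<open>\<tau> i + u i\<close> cut off at \<open>u i < \<delta> i\<close>, and at each \<open>t\<close> only the next
  departure contributes to it. For a fixed route, \<open>t \<mapsto> u i\<close> is a reflection of the circle of length \<open>T\<close>
  and preserves the integral over a period, so route \<open>i\<close> contributes the integral of
  \<open>\<tau> i + u\<close> over \<open>0 \<le> u < \<delta> i\<close>, that is \<open>\<delta>\<^sup>2/2 + \<tau> \<delta>\<close>. Working with this sum instead of
  an ordered list of departure times avoids sorting the timetable and
  treating separately the interval that wraps around the end of the period.

  For the second equation, \<open>x\<^sup>2/2 + \<tau> x = ((x + \<tau>)\<^sup>2 - \<tau>\<^sup>2)/2\<close>, and \<open>\<Delta> i + \<tau> i\<close> is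
  \<open>\<delta> + \<tau>\<close> at the successor of \<open>i\<close>. As the successor map permutes the routes
  (\<open>bij_betw_succ_route\<close>), both sums of squares agree.
\<close>

section \<open>First and last routes of the departure order\<close>

lemma departs_before_irrefl: "\<not> departs_before \<theta> i i"
  and departs_before_trans: "departs_before \<theta> i j \<Longrightarrow> departs_before \<theta> j k \<Longrightarrow> departs_before \<theta> i k"
  and departs_before_asym: "departs_before \<theta> i j \<Longrightarrow> \<not> departs_before \<theta> j i"
  and departs_before_linear: "i \<noteq> j \<Longrightarrow> departs_before \<theta> i j \<or> departs_before \<theta> j i"
  by (auto simp: departs_before_def)

lemma ex_first_route:
  assumes "finite A" "A \<noteq> {}"
  shows "\<exists>i\<in>A. \<forall>j\<in>A. j \<noteq> i \<longrightarrow> departs_before \<theta> i j"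
  using assms
proof (induction rule: finite_ne_induct)
  case (insert x F)
  then obtain i where i: "i \<in> F" "\<forall>j\<in>F. j \<noteq> i \<longrightarrow> departs_before \<theta> i j" by blast
  with insert.hyps departs_before_linear[of x i \<theta>] show ?case
    by (metis departs_before_trans insert_iff)
qed simp

lemma ex_last_route:
  assumes "finite A" "A \<noteq> {}"
  shows "\<exists>i\<in>A. \<forall>j\<in>A. j \<noteq> i \<longrightarrow> departs_before \<theta> j i"
  using assms
proof (induction rule: finite_ne_induct)
  case (insert x F)
  then obtain i where i: "i \<in> F" "\<forall>j\<in>F. j \<noteq> i \<longrightarrow> departs_before \<theta> j i" by blast
  with insert.hyps departs_before_linear[of x i \<theta>] show ?case
    by (metis departs_before_trans insert_iff)
qed simp

lemma first_route:
  assumes "finite A" "A \<noteq> {}"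
  shows "first_route \<theta> A \<in> A"
    and "\<And>j. j \<in> A \<Longrightarrow> j \<noteq> first_route \<theta> A \<Longrightarrow> departs_before \<theta> (first_route \<theta> A) j"
proof -
  have "\<exists>!i. i \<in> A \<and> (\<forall>j\<in>A. j \<noteq> i \<longrightarrow> departs_before \<theta> i j)"
    using ex_first_route[OF assms, of \<theta>] by (metis departs_before_asym)
  from theI'[OF this]
  show "first_route \<theta> A \<in> A"
    and "\<And>j. j \<in> A \<Longrightarrow> j \<noteq> first_route \<theta> A \<Longrightarrow> departs_before \<theta> (first_route \<theta> A) j"
    by (auto simp: first_route_def)
qed

lemma last_route:
  assumes "finite A" "A \<noteq> {}"
  shows "last_route \<theta> A \<in> A"
    and "\<And>j. j \<in> A \<Longrightarrow> j \<noteq> last_route \<theta> A \<Longrightarrow> departs_before \<theta> j (last_route \<theta> A)"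
proof -
  have "\<exists>!i. i \<in> A \<and> (\<forall>j\<in>A. j \<noteq> i \<longrightarrow> departs_before \<theta> j i)"
    using ex_last_route[OF assms, of \<theta>] by (metis departs_before_asym)
  from theI'[OF this]
  show "last_route \<theta> A \<in> A"
    and "\<And>j. j \<in> A \<Longrightarrow> j \<noteq> last_route \<theta> A \<Longrightarrow> departs_before \<theta> j (last_route \<theta> A)"
    by (auto simp: last_route_def)
qed

lemma succ_route_in:
  assumes "n \<ge> 1"
  shows "succ_route n \<theta> i \<in> {1..n}"
proof -
  define A where "A = {j \<in> {1..n}. departs_before \<theta> i j}"
  have "first_route \<theta> (if A = {} then {1..n} else A) \<in> (if A = {} then {1..n} else A)"
    using assms by (intro first_route(1)) (auto simp: A_def)
  then show ?thesis
    by (auto simp: succ_route_def Let_def A_def split: if_splits)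
qed

lemma succ_route_no_gap:
  assumes "k \<in> {1..n}" "departs_before \<theta> i k"
  shows "succ_route n \<theta> i = k \<or> departs_before \<theta> (succ_route n \<theta> i) k"
    and "departs_before \<theta> i (succ_route n \<theta> i)"
proof -
  define A where "A = {j \<in> {1..n}. departs_before \<theta> i j}"
  have k: "k \<in> A" "finite A" "A \<noteq> {}" using assms by (auto simp: A_def)
  then have eq: "succ_route n \<theta> i = first_route \<theta> A"
    unfolding succ_route_def Let_def A_def[symmetric] by simp
  show "succ_route n \<theta> i = k \<or> departs_before \<theta> (succ_route n \<theta> i) k"
    using first_route(2)[OF k(2,3,1), of \<theta>] eq by metis
  show "departs_before \<theta> i (succ_route n \<theta> i)"
    using first_route(1)[OF k(2,3), of \<theta>] eq by (simp add: A_def)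
qed

lemma succ_route_of_last:
  assumes "k \<in> {1..n}" "\<forall>j\<in>{1..n}. \<not> departs_before \<theta> i j"
  shows "succ_route n \<theta> i = k \<or> departs_before \<theta> (succ_route n \<theta> i) k"
proof -
  have "{j \<in> {1..n}. departs_before \<theta> i j} = {}" using assms(2) by blast
  then have "succ_route n \<theta> i = first_route \<theta> {1..n}"
    by (simp add: succ_route_def)
  then show ?thesis
    using first_route(2)[of "{1..n}" k \<theta>] assms by force
qed

text \<open>
  It suffices to show injectivity. If \<open>i\<close> departs before \<open>k\<close>, the successor of \<open>i\<close> lies after
  \<open>i\<close> and not beyond \<open>k\<close>, whereas the successor of \<open>k\<close> lies beyond \<open>k\<close> or, after
  wrapping around, not beyond \<open>i\<close>.
\<close>

lemma bij_betw_succ_route: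
  assumes n: "n \<ge> 1"
  shows "bij_betw (succ_route n \<theta>) {1..n} {1..n}"
proof -
  have less: "succ_route n \<theta> i \<noteq> succ_route n \<theta> k"
    if ik: "i \<in> {1..n}" "k \<in> {1..n}" "departs_before \<theta> i k" for i k
  proof (cases "\<exists>m\<in>{1..n}. departs_before \<theta> k m")
    case True
    then have "departs_before \<theta> k (succ_route n \<theta> k)"
      using succ_route_no_gap(2) by blast
    then show ?thesis
      using succ_route_no_gap(1)[OF ik(2,3)] departs_before_asym by metis
  next
    case False
    then have "succ_route n \<theta> k = i \<or> departs_before \<theta> (succ_route n \<theta> k) i"
      using succ_route_of_last[OF ik(1)] by blast
    then show ?thesis
      using succ_route_no_gap(2)[OF ik(2,3)] departs_before_asym by metis
  qed
  have "inj_on (succ_route n \<theta>) {1..n}"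
  proof (rule inj_onI, rule ccontr)
    fix i k assume "i \<in> {1..n}" "k \<in> {1..n}" "succ_route n \<theta> i = succ_route n \<theta> k" "i \<noteq> k"
    with less[of i k] less[of k i] departs_before_linear[of i k \<theta>] show False by auto
  qed
  moreover have "succ_route n \<theta> ` {1..n} \<subseteq> {1..n}"
    using succ_route_in[OF n] by blast
  ultimately show ?thesis
    by (simp add: bij_betw_def endo_inj_surj)
qed

section \<open>Waiting times and the change of origin\<close>

lemma rmod_diff_representatives:
  assumes "x \<in> {0..<T}" "y \<in> {0..<T}"
  shows "(x - y) rmod T = (if y \<le> x then x - y else x - y + T)"
proof (cases "y \<le> x")
  case True
  then show ?thesis using assms by (simp add: rmod_idem)
next
  case False
  have "[x - y + T = x - y] (rmod T)"
    unfolding rcong_altdef by (rule exI[of _ "-1"]) simp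
  then have "(x - y) rmod T = (x - y + T) rmod T"
    by (simp add: rcong_def)
  then show ?thesis using assms False by (simp add: rmod_idem)
qed

text \<open>
  The rule that a tie costs a full period to the route with the larger index is what lets
  the order \<^const>\<open>departs_before\<close>, ties included, decide when the period is added.
\<close>

lemma wait_representatives:
  assumes "\<theta> i \<in> {0..<T}" "\<theta> j \<in> {0..<T}"
  shows "wait T \<theta> i j = \<theta> j - \<theta> i + (if departs_before \<theta> j i then T else 0)"
  using assms
  by (auto simp: wait_def departs_before_def rmod_diff_representatives)

text \<open>
  Differences of departure times, and the coincidences that trigger the tie rule, are the
  same for all origins modulo \<open>T\<close>.
\<close>

lemma wait_change_origin:
  assumes "T > 0" "\<theta> i \<in> {0..<T}" "\<theta> j \<in> {0..<T}"
  shows "wait T (\<lambda>k. (\<theta> k - t) rmod T) i j = wait T \<theta> i j"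
proof -
  have *: "((\<theta> j - t) rmod T - (\<theta> i - t) rmod T) rmod T = (\<theta> j - \<theta> i) rmod T"
    by (simp add: rmod_diff)
  have "\<theta> i = \<theta> j" if "(\<theta> i - t) rmod T = (\<theta> j - t) rmod T"
  proof -
    from * that have "(\<theta> j - \<theta> i) rmod T = 0" by simp
    with assms show ?thesis by (auto simp: rmod_diff_representatives split: if_splits)
  qed
  with * show ?thesis by (auto simp: wait_def)
qed

text \<open>
  Among the other routes, the predecessor is one from which the wait for \<open>i\<close> is shortest. This
  is the property through which predecessors enter the rest of the proof.
\<close>

lemma pred_route_wait_le:
  assumes \<theta>: "\<forall>i\<in>{1..n}. \<theta> i \<in> {0..<T}"
    and ij: "i \<in> {1..n}" "j \<in> {1..n}" "j \<noteq> i"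
  shows "pred_route n \<theta> i \<in> {1..n}" "pred_route n \<theta> i \<noteq> i"
    and "wait T \<theta> (pred_route n \<theta> i) i \<le> wait T \<theta> j i"
proof -
  define p where "p = pred_route n \<theta> i"
  define E where "E = {j \<in> {1..n}. departs_before \<theta> j i}"
  have "p \<in> {1..n} \<and> p \<noteq> i \<and> wait T \<theta> p i \<le> wait T \<theta> j i"
  proof (cases "E = {}")
    case True
    have ne: "finite {1..n}" "{1..n} \<noteq> {}" using ij by auto
    have p: "p = last_route \<theta> {1..n}"
      using True unfolding p_def pred_route_def Let_def E_def[symmetric] by simp
    have first: "departs_before \<theta> i k" if "k \<in> {1..n}" "k \<noteq> i" for k
      using True that departs_before_linear unfolding E_def by blast
    have pin: "p \<in> {1..n}" using last_route(1)[OF ne] p by simp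
    moreover have pi: "p \<noteq> i"
      using last_route(2)[OF ne ij(2), of \<theta>] first[OF ij(2,3)] ij(3) departs_before_asym
      unfolding p by metis
    moreover have "\<theta> j \<le> \<theta> p"
      using last_route(2)[OF ne ij(2), of \<theta>] unfolding p departs_before_def by force
    ultimately show ?thesis
      using \<theta> ij first[OF ij(2,3)] first[of p] by (simp add: wait_representatives)
  next
    case False
    then have p: "p = last_route \<theta> E"
      unfolding p_def pred_route_def Let_def E_def[symmetric] by simp
    have fin: "finite E" by (simp add: E_def)
    have pE: "p \<in> E" using last_route(1)[OF fin False] p by simp
    then have pin: "p \<in> {1..n}" "departs_before \<theta> p i" by (auto simp: E_def)
    then have "\<not> departs_before \<theta> i p" "p \<noteq> i"
      using departs_before_asym departs_before_irrefl by blast+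
    moreover have "\<theta> j \<le> \<theta> p" if "\<not> departs_before \<theta> i j"
    proof -
      have "j \<in> E" using that departs_before_linear ij by (auto simp: E_def)
      then show ?thesis
        using last_route(2)[OF fin False, of j \<theta>] unfolding p departs_before_def by force
    qed
    ultimately show ?thesis
      using \<theta> ij pin by (auto simp: wait_representatives) (smt (verit) atLeastAtMost_iff atLeastLessThan_iff)+
  qed
  then show "pred_route n \<theta> i \<in> {1..n}" "pred_route n \<theta> i \<noteq> i"
    and "wait T \<theta> (pred_route n \<theta> i) i \<le> wait T \<theta> j i"
    by (auto simp: p_def)
qed

lemma char_delta_bounds:
  assumes "T > 0"
  shows "0 \<le> char_delta n T \<theta> i" "char_delta n T \<theta> i \<le> T"
  using assms rmod_nonneg[of T] rmod_le[of T]
  by (auto simp: char_delta_def wait_def)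

text \<open>
  From the origin \<open>t\<close> and for \<open>k \<noteq> i\<close>, \<open>wait T \<theta> k i\<close> is \<open>u i - u k\<close>, increased by \<open>T\<close> if \<open>i\<close> comes before \<open>k\<close>.
  As \<open>0 \<le> u k < T\<close>, it exceeds \<open>u i\<close> exactly if \<open>i\<close> comes before \<open>k\<close>, and \<open>\<delta> i\<close> is the least of
  these waits. For a single route both sides hold, since \<open>\<delta> = T\<close>.
\<close>

lemma less_char_delta_iff_first:
  fixes t T :: real
  assumes T: "T > 0" and \<theta>: "\<forall>i\<in>{1..n}. \<theta> i \<in> {0..<T}" and i: "i \<in> {1..n}"
  defines "u \<equiv> \<lambda>j. (\<theta> j - t) rmod T"
  shows "u i < char_delta n T \<theta> i \<longleftrightarrow> (\<forall>k\<in>{1..n}. k \<noteq> i \<longrightarrow> departs_before u i k)"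
proof (cases "n = 1")
  case True
  then show ?thesis using T i by (simp add: char_delta_def u_def rmod_less)
next
  case False
  have u: "u k \<in> {0..<T}" for k
    using T by (simp add: u_def rmod_less rmod_nonneg)
  have w: "wait T \<theta> k i = u i - u k + (if departs_before u i k then T else 0)"
    if "k \<in> {1..n}" for k
    using wait_change_origin[OF T, of \<theta> k i t] wait_representatives[of u k T i] u that i \<theta>
    by (simp add: u_def)
  define p where "p = pred_route n \<theta> i"
  have \<delta>: "char_delta n T \<theta> i = wait T \<theta> p i"
    using False by (simp add: char_delta_def p_def)
  have p: "p \<in> {1..n}" "p \<noteq> i"
  proof -
    \<comment> \<open>Any route other than \<open>i\<close> serves to invoke the minimality of the predecessor.\<close>
    define j where "j = (if i = 1 then 2 else 1 :: nat)"
    have "j \<in> {1..n}" "j \<noteq> i" using False i by (auto simp: j_def)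
    then show "p \<in> {1..n}" "p \<noteq> i"
      using pred_route_wait_le(1,2)[OF \<theta> i] by (auto simp: p_def)
  qed
  show ?thesis
  proof safe
    fix k assume "u i < char_delta n T \<theta> i" and k: "k \<in> {1..n}" "k \<noteq> i"
    then have "u i < wait T \<theta> k i"
      using pred_route_wait_le(3)[OF \<theta> i k] \<delta> by (simp add: p_def)
    with w[OF k(1)] u[of k] show "departs_before u i k"
      by (auto split: if_splits)
  next
    assume "\<forall>k\<in>{1..n}. k \<noteq> i \<longrightarrow> departs_before u i k"
    with p w[OF p(1)] \<delta> u[of p] show "u i < char_delta n T \<theta> i" by simp
  qed
qed

section \<open>The observed measure as a function of the departure time\<close>

lemma aggregate_add_const:
  assumes "n \<ge> 1" and "r = Shortest_Path \<or> (\<exists>\<beta>>0. r = Logit \<beta>)"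
  shows "aggregate r n (\<lambda>j. d j + c) = aggregate r n d + c"
  using assms(2)
proof (elim disjE exE conjE)
  assume "r = Shortest_Path"
  then show ?thesis using Min_add_commute[of "{1..n}" d c] assms(1) by simp
next
  fix \<beta> :: real assume \<beta>: "\<beta> > 0" "r = Logit \<beta>"
  have pos: "(\<Sum>i\<in>{1..n}. exp (- \<beta> * d i)) > 0"
    using assms(1) by (intro sum_pos) auto
  have "(\<Sum>i\<in>{1..n}. exp (- \<beta> * (d i + c))) = exp (- \<beta> * c) * (\<Sum>i\<in>{1..n}. exp (- \<beta> * d i))"
    by (simp add: sum_distrib_left algebra_simps flip: exp_add)
  then show ?thesis
    using \<beta> pos by (simp add: ln_mult field_simps)
qed

lemma aggregate_cong:
  assumes "\<And>j. j \<in> {1..n} \<Longrightarrow> d j = d' j"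
  shows "aggregate r n d = aggregate r n d'"
proof -
  have "d ` {1..n} = d' ` {1..n}" using assms by (intro image_cong) auto
  moreover have "(\<Sum>i\<in>{1..n}. exp (- \<beta> * d i)) = (\<Sum>i\<in>{1..n}. exp (- \<beta> * d' i))" for \<beta>
    using assms by (intro sum.cong) auto
  ultimately show ?thesis by (cases r) simp_all
qed

text \<open>
  The separate convention for a single route agrees with the general formula: its wait for
  itself is zero, and aggregating one duration returns it.
\<close>

lemma char_tau_eq_aggregate:
  assumes "i \<in> {1..n}" and "r = Shortest_Path \<or> (\<exists>\<beta>>0. r = Logit \<beta>)"
  shows "char_tau r n l T \<theta> i = aggregate r n (\<lambda>j. l j + wait T \<theta> i j)"
  using assms by (auto simp: char_tau_def wait_def)

text \<open>
  Nothing departs before \<open>i\<close>, so waiting for \<open>j\<close> is the same as waiting for \<open>i\<close> and from there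
  for \<open>j\<close>. The common part \<open>u i\<close> moves out of the aggregate.
\<close>

lemma observed_measure_first:
  fixes t T :: real
  assumes r: "r = Shortest_Path \<or> (\<exists>\<beta>>0. r = Logit \<beta>)"
    and T: "T > 0" and \<theta>: "\<forall>i\<in>{1..n}. \<theta> i \<in> {0..<T}" and i: "i \<in> {1..n}"
  defines "u \<equiv> \<lambda>j. (\<theta> j - t) rmod T"
  assumes first: "\<forall>k\<in>{1..n}. k \<noteq> i \<longrightarrow> departs_before u i k"
  shows "observed_measure r n l T \<theta> t = char_tau r n l T \<theta> i + u i"
proof -
  have u: "u k \<in> {0..<T}" for k
    using T by (simp add: u_def rmod_less rmod_nonneg)
  have w: "wait T \<theta> i j + u i = u j" if j: "j \<in> {1..n}" for j
  proof -
    have "\<not> departs_before u j i"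
      using first j departs_before_asym departs_before_irrefl by metis
    then show ?thesis
      using wait_change_origin[OF T, of \<theta> i j t] wait_representatives[of u i T j] u j i \<theta>
      by (simp add: u_def)
  qed
  have "observed_measure r n l T \<theta> t = aggregate r n (\<lambda>j. (l j + wait T \<theta> i j) + u i)"
    unfolding observed_measure_def
    by (intro aggregate_cong) (use w in \<open>force simp: observed_duration_def u_def\<close>)
  also have "\<dots> = char_tau r n l T \<theta> i + u i"
    using aggregate_add_const[OF _ r] char_tau_eq_aggregate[OF i r] i by simp
  finally show ?thesis .
qed

text \<open>
  Cost of waiting \<open>u\<close> for a route with characteristic values \<open>\<delta>\<close> and \<open>\<tau>\<close>, counted only if that
  route is the next to depart.
\<close>

definition slot_cost :: "real \<Rightarrow> real \<Rightarrow> real \<Rightarrow> real" where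
  "slot_cost \<delta> \<tau> u = (if u < \<delta> then \<tau> + u else 0)"

text \<open>
  Exactly one route is first from the origin \<open>t\<close>, so the other summands vanish.
\<close>

lemma observed_measure_eq_sum:
  assumes r: "r = Shortest_Path \<or> (\<exists>\<beta>>0. r = Logit \<beta>)"
    and n: "n \<ge> 1" and T: "T > 0" and \<theta>: "\<forall>i\<in>{1..n}. \<theta> i \<in> {0..<T}"
  shows "observed_measure r n l T \<theta> t =
    (\<Sum>i\<in>{1..n}. slot_cost (char_delta n T \<theta> i) (char_tau r n l T \<theta> i) ((\<theta> i - t) rmod T))"
proof -
  define u where "u = (\<lambda>j. (\<theta> j - t) rmod T)"
  obtain i where i: "i \<in> {1..n}" and first: "\<forall>k\<in>{1..n}. k \<noteq> i \<longrightarrow> departs_before u i k"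
    using ex_first_route[of "{1..n}" u] n by auto
  have "slot_cost (char_delta n T \<theta> k) (char_tau r n l T \<theta> k) (u k) =
      (if k = i then char_tau r n l T \<theta> i + u i else 0)" if k: "k \<in> {1..n}" for k
  proof (cases "k = i")
    case True
    then show ?thesis
      using less_char_delta_iff_first[OF T \<theta> i, of t] first by (simp add: slot_cost_def u_def)
  next
    case False
    then have "\<not> departs_before u k i"
      using first k departs_before_asym by blast
    then show ?thesis
      using less_char_delta_iff_first[OF T \<theta> k, of t] i False
      by (auto simp: slot_cost_def u_def)
  qed
  then have "(\<Sum>k\<in>{1..n}. slot_cost (char_delta n T \<theta> k) (char_tau r n l T \<theta> k) (u k)) =
      char_tau r n l T \<theta> i + u i"
    using i by simp
  also have "\<dots> = observed_measure r n l T \<theta> t"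
    using observed_measure_first[OF r T \<theta> i, of t] first by (simp add: u_def)
  finally show ?thesis by (simp add: u_def)
qed

section \<open>Integration over one period\<close>

lemma borel_measurable_rmod [measurable (raw)]:
  assumes [measurable]: "f \<in> borel_measurable M"
  shows "(\<lambda>x. f x rmod T) \<in> borel_measurable M"
  unfolding rmod_def by measurable

lemma
  fixes f :: "real \<Rightarrow> real"
  shows set_integral_reflect: "(LBINT t:A. f (c - t)) = (LBINT u:{u. c - u \<in> A}. f u)"
    and set_integrable_reflect:
      "set_integrable lborel {u. c - u \<in> A} f \<Longrightarrow> set_integrable lborel A (\<lambda>t. f (c - t))"
proof -
  have ind: "indicator {u. c - u \<in> A} (c + - 1 * t) = (indicator A t :: real)" for t
    by (auto simp: indicator_def)
  show "(LBINT t:A. f (c - t)) = (LBINT u:{u. c - u \<in> A}. f u)"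
    using lborel_integral_real_affine[of "-1" "\<lambda>u. indicator {u. c - u \<in> A} u *\<^sub>R f u" c] ind
    by (simp add: set_lebesgue_integral_def)
  show "set_integrable lborel A (\<lambda>t. f (c - t))"
    if "set_integrable lborel {u. c - u \<in> A} f"
    using lborel_integrable_real_affine[OF that[unfolded set_integrable_def], of "-1" c] ind
    by (simp add: set_integrable_def)
qed

text \<open>
  As \<open>t\<close> runs through \<open>[0, \<theta>]\<close> and then \<open>(\<theta>, T)\<close>, the wait runs backwards through
  \<open>[0, \<theta>]\<close> and then through \<open>(\<theta>, T)\<close>: each of the two pieces is mapped onto itself by a
  reflection, about \<open>\<theta>/2\<close> and \<open>(\<theta> + T)/2\<close> respectively.
\<close>

lemma
  fixes g :: "real \<Rightarrow> real"
  assumes \<theta>: "\<theta> \<in> {0..<T}" and g: "set_integrable lborel {0..<T} g"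
  shows set_integral_rmod_reflect: "(LBINT t:{0..<T}. g ((\<theta> - t) rmod T)) = (LBINT u:{0..<T}. g u)"
    and set_integrable_rmod_reflect: "set_integrable lborel {0..<T} (\<lambda>t. g ((\<theta> - t) rmod T))"
proof -
  let ?h = "\<lambda>t. g ((\<theta> - t) rmod T)"
  have split: "{0..<T} = {0..\<theta>} \<union> {\<theta><..<T}" "{0..\<theta>} \<inter> {\<theta><..<T} = {}"
    using \<theta> by auto
  have refl1: "{u. \<theta> - u \<in> {0..\<theta>}} = {0..\<theta>}"
    and refl2: "{u. \<theta> + T - u \<in> {\<theta><..<T}} = {\<theta><..<T}"
    by auto
  have h1: "?h t = g (\<theta> - t)" if "t \<in> {0..\<theta>}" for t
    using that \<theta> by (simp add: rmod_diff_representatives)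
  have h2: "?h t = g (\<theta> + T - t)" if "t \<in> {\<theta><..<T}" for t
    using that \<theta> by (simp add: rmod_diff_representatives algebra_simps)
  have g1: "set_integrable lborel {0..\<theta>} g" and g2: "set_integrable lborel {\<theta><..<T} g"
    using \<theta> by (auto intro!: set_integrable_subset[OF g])
  have i1: "set_integrable lborel {0..\<theta>} ?h"
    using set_integrable_reflect[of \<theta> "{0..\<theta>}" g] g1 refl1 h1
    by (subst set_integrable_cong[OF refl refl h1]) auto
  have i2: "set_integrable lborel {\<theta><..<T} ?h"
    using set_integrable_reflect[of "\<theta> + T" "{\<theta><..<T}" g] g2 refl2 h2
    by (subst set_integrable_cong[OF refl refl h2]) auto
  show "set_integrable lborel {0..<T} ?h"
    unfolding split(1) by (intro set_integrable_Un i1 i2) auto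
  have e1: "(LBINT t:{0..\<theta>}. ?h t) = (LBINT u:{0..\<theta>}. g u)"
    using set_integral_reflect[of "{0..\<theta>}" g \<theta>] h1 refl1
    by (subst set_lebesgue_integral_cong[of _ _ _ "\<lambda>t. g (\<theta> - t)"]) auto
  have e2: "(LBINT t:{\<theta><..<T}. ?h t) = (LBINT u:{\<theta><..<T}. g u)"
    using set_integral_reflect[of "{\<theta><..<T}" g "\<theta> + T"] h2 refl2
    by (subst set_lebesgue_integral_cong[of _ _ _ "\<lambda>t. g (\<theta> + T - t)"]) auto
  show "(LBINT t:{0..<T}. ?h t) = (LBINT u:{0..<T}. g u)"
    unfolding split(1)
    by (simp add: set_integral_Un[OF split(2) i1 i2] set_integral_Un[OF split(2) g1 g2] e1 e2)
qed

lemma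
  assumes \<delta>: "0 \<le> \<delta>" "\<delta> \<le> T"
  shows set_integral_slot_cost: "(LBINT u:{0..<T}. slot_cost \<delta> \<tau> u) = 1 / 2 * \<delta>\<^sup>2 + \<tau> * \<delta>"
    and set_integrable_slot_cost: "set_integrable lborel {0..<T} (slot_cost \<delta> \<tau>)"
proof -
  have meas [measurable]: "slot_cost \<delta> \<tau> \<in> borel_measurable borel"
    unfolding slot_cost_def by measurable
  \<comment> \<open>The cut-off is strict at \<open>\<delta>\<close>; the closed interval differs from it by a null set.\<close>
  have ae: "AE u in lborel. indicator {0..\<delta>} u *\<^sub>R (\<tau> + u) = indicator {0..<T} u *\<^sub>R slot_cost \<delta> \<tau> u"
    using AE_lborel_singleton[of \<delta>]
    by eventually_elim (use \<delta> in \<open>auto simp: slot_cost_def indicator_def\<close>)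
  have "set_integrable lborel {0..\<delta>} (\<lambda>u. \<tau> + u)"
    by (intro borel_integrable_atLeastAtMost' continuous_intros)
  then show "set_integrable lborel {0..<T} (slot_cost \<delta> \<tau>)"
    unfolding set_integrable_def
    by (rule integrable_cong_AE_imp[OF _ _ ae]) auto
  have "(LBINT u:{0..<T}. slot_cost \<delta> \<tau> u) = (\<integral>u. indicator {0..\<delta>} u *\<^sub>R (\<tau> + u) \<partial>lborel)"
    unfolding set_lebesgue_integral_def using ae
    by (intro integral_cong_AE) (auto elim: AE_mp)
  also have "\<dots> = (\<tau> * \<delta> + \<delta>\<^sup>2 / 2) - (\<tau> * 0 + 0\<^sup>2 / 2)"
    by (rule integral_FTC_atLeastAtMost[OF \<delta>(1)])
      (auto intro!: derivative_eq_intros continuous_intros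
        simp flip: has_real_derivative_iff_has_vector_derivative)
  finally show "(LBINT u:{0..<T}. slot_cost \<delta> \<tau> u) = 1 / 2 * \<delta>\<^sup>2 + \<tau> * \<delta>" by simp
qed

lemma integral_uniform_measure_Ico:
  fixes f :: "real \<Rightarrow> real"
  assumes T: "T > 0" and [measurable]: "f \<in> borel_measurable borel"
  shows "(\<integral>t. f t \<partial>uniform_measure lborel {0..<T}) = 1 / T * (LBINT t:{0..<T}. f t)"
proof -
  have "uniform_measure lborel {0..<T} = density lborel (\<lambda>t. ennreal (indicator {0..<T} t / T))"
    unfolding uniform_measure_def using T
    by (intro density_cong) (auto simp: indicator_def divide_ennreal ennreal_1[symmetric] simp del: ennreal_1)
  then have "(\<integral>t. f t \<partial>uniform_measure lborel {0..<T}) = (\<integral>t. (indicator {0..<T} t / T) *\<^sub>R f t \<partial>lborel)"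
    using T by (simp add: integral_density)
  also have "\<dots> = (\<integral>t. 1 / T * (indicator {0..<T} t *\<^sub>R f t) \<partial>lborel)"
    by (intro Bochner_Integration.integral_cong) auto
  finally show ?thesis
    by (simp only: integral_mult_right_zero set_lebesgue_integral_def)
qed

lemma timetable_measure_eq_sum_delta:
  assumes r: "r = Shortest_Path \<or> (\<exists>\<beta>>0. r = Logit \<beta>)"
    and n: "n \<ge> 1" and T: "T > 0" and \<theta>: "\<forall>i\<in>{1..n}. \<theta> i \<in> {0..<T}"
  shows "timetable_measure r n l T \<theta> =
    1 / T * (\<Sum>i\<in>{1..n}. 1 / 2 * (char_delta n T \<theta> i)\<^sup>2
                            + char_tau r n l T \<theta> i * char_delta n T \<theta> i)"
proof -
  define g where "g i = slot_cost (char_delta n T \<theta> i) (char_tau r n l T \<theta> i)" for i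
  have obs: "observed_measure r n l T \<theta> = (\<lambda>t. \<Sum>i\<in>{1..n}. g i ((\<theta> i - t) rmod T))"
    using observed_measure_eq_sum[OF r n T \<theta>] by (simp add: g_def fun_eq_iff)
  have [measurable]: "g i \<in> borel_measurable borel" for i
    unfolding g_def slot_cost_def by measurable
  have int: "set_integrable lborel {0..<T} (g i)"
    and val: "(LBINT u:{0..<T}. g i u) = 1 / 2 * (char_delta n T \<theta> i)\<^sup>2
                + char_tau r n l T \<theta> i * char_delta n T \<theta> i" if "i \<in> {1..n}" for i
    using set_integrable_slot_cost set_integral_slot_cost char_delta_bounds[OF T]
    by (auto simp: g_def)
  have "timetable_measure r n l T \<theta> =
      1 / T * (LBINT t:{0..<T}. \<Sum>i\<in>{1..n}. g i ((\<theta> i - t) rmod T))"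
    unfolding timetable_measure_def obs by (rule integral_uniform_measure_Ico[OF T]) measurable
  also have "(LBINT t:{0..<T}. \<Sum>i\<in>{1..n}. g i ((\<theta> i - t) rmod T)) =
      (\<Sum>i\<in>{1..n}. LBINT t:{0..<T}. g i ((\<theta> i - t) rmod T))"
    unfolding set_lebesgue_integral_def scaleR_sum_right
  proof (rule Bochner_Integration.integral_sum)
    fix i assume i: "i \<in> {1..n}"
    then show "integrable lborel (\<lambda>t. indicator {0..<T} t *\<^sub>R g i ((\<theta> i - t) rmod T))"
      using set_integrable_rmod_reflect[OF _ int[OF i], of "\<theta> i"] \<theta>
      by (simp add: set_integrable_def)
  qed
  also have "\<dots> = (\<Sum>i\<in>{1..n}. 1 / 2 * (char_delta n T \<theta> i)\<^sup>2
                            + char_tau r n l T \<theta> i * char_delta n T \<theta> i)"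
    using \<theta> int val by (intro sum.cong) (auto simp: set_integral_rmod_reflect)
  finally show ?thesis .
qed

section \<open>From gaps to cost differences\<close>

lemma sum_delta_eq_sum_Delta:
  fixes n :: nat and T :: real and l \<theta> :: "nat \<Rightarrow> real" and r :: routing
  assumes n: "n \<ge> 1"
  defines "\<delta> \<equiv> char_delta n T \<theta>" and "\<tau> \<equiv> char_tau r n l T \<theta>" and "\<Delta> \<equiv> char_Delta r n l T \<theta>"
  shows "(\<Sum>i\<in>{1..n}. 1 / 2 * (\<delta> i)\<^sup>2 + \<tau> i * \<delta> i) = (\<Sum>i\<in>{1..n}. 1 / 2 * (\<Delta> i)\<^sup>2 + \<tau> i * \<Delta> i)"
proof -
  let ?\<sigma> = "succ_route n \<theta>"
  have square: "1 / 2 * x\<^sup>2 + y * x = ((x + y)\<^sup>2 - y\<^sup>2) / 2" for x y :: real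
    by (simp add: power2_eq_square algebra_simps)
  have "\<Delta> i + \<tau> i = \<delta> (?\<sigma> i) + \<tau> (?\<sigma> i)" for i
    by (simp add: \<Delta>_def \<delta>_def \<tau>_def char_Delta_def)
  then have "(\<Sum>i\<in>{1..n}. (\<Delta> i + \<tau> i)\<^sup>2) = (\<Sum>i\<in>{1..n}. (\<delta> i + \<tau> i)\<^sup>2)"
    using sum.reindex_bij_betw[OF bij_betw_succ_route[OF n, of \<theta>], of "\<lambda>i. (\<delta> i + \<tau> i)\<^sup>2"] by simp
  then show ?thesis
    unfolding square by (simp add: sum_subtractf flip: sum_divide_distrib)
qed

section \<open>The timetable measure under uniform arrivals\<close>

theorem proposition5:
  fixes n :: nat and l \<theta> :: "nat \<Rightarrow> real" and T :: real and r :: routing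
  assumes "n \<ge> 1"
    and "T > 0"
    and "\<forall>i\<in>{1..n}. 0 \<le> \<theta> i \<and> \<theta> i < T"
    and "r = Shortest_Path \<or> (\<exists>\<beta>>0. r = Logit \<beta>)"
  shows "timetable_measure r n l T \<theta> =
           1 / T * (\<Sum>i\<in>{1..n}. 1 / 2 * (char_delta n T \<theta> i)\<^sup>2
                                 + char_tau r n l T \<theta> i * char_delta n T \<theta> i)
       \<and> 1 / T * (\<Sum>i\<in>{1..n}. 1 / 2 * (char_delta n T \<theta> i)\<^sup>2
                                 + char_tau r n l T \<theta> i * char_delta n T \<theta> i) =
           1 / T * (\<Sum>i\<in>{1..n}. 1 / 2 * (char_Delta r n l T \<theta> i)\<^sup>2
                                 + char_tau r n l T \<theta> i * char_Delta r n l T \<theta> i)"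
  using timetable_measure_eq_sum_delta[OF assms(4,1,2), of \<theta> l]
    sum_delta_eq_sum_Delta[OF assms(1), of T \<theta> r l] assms(3)
  by simp

end
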